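(* Let $\alpha\in(0,1)$ be irrational and let $s_\alpha$ be a Sturmian word of angle $\alpha$. Then $A(s_\alpha)=\lambda(\alpha)$; that is, the abelian critical exponent of a Sturmian word equals the Lagrange constant of its angle.
   Context: $\{x\}=x-\lfloor x\rfloor$ is the fractional part and $\|x\|=\min(\{x\},1-\{x\})$ is the distance from $x$ to the nearest integer. For irrational $\alpha\in(0,1)$ and $\rho\in[0,1)$, a Sturmian word of angle $\alpha$ and initial point $\rho$ is the infinite word $a_0a_1a_2\cdots$ over $\{a,b\}$ with $a_n=b$ if $\{\rho+n\alpha\}\in I_b$ and $a_n=a$ if $\{\rho+n\alpha\}\in I_a$, where either $I_b=[0,1-\alpha)$, $I_a=[1-\alpha,1)$, or $I_b=(0,1-\alpha]$, $I_a=(1-\alpha,1]$ with $0$ identified with $1$. $s_\alpha$ denotes any Sturmian word of angle $\alpha$. The Parikh vector $\mathcal{P}$ of a word over $\{a,b\}$ is the pair (number of $a$'s, number of $b$'s), with norm $|\mathcal P|$ the sum of its components. $\mathcal{P}$ is contained in $\mathcal{Q}$ if $|\mathcal P|<|\mathcal Q|$ and $\mathcal P\leq\mathcal Q$ componentwise. A word $w$ is an abelian power of period $m$ and exponent $k$ if $w=u_1\cdots u_k$ where all $u_i$ have length $m$ and the same Parikh vector. A word $w$ is an abelian repetition of period $m$ and exponent $|w|/m$ if $w=u_0u_1\cdots u_{j-1}u_j$ with $j\geq3$, where $u_1,\dots,u_{j-1}$ have length $m$ and the same Parikh vector $\mathcal P$, and the Parikh vectors of $u_0$ and $u_j$ (possibly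 empty words) are contained in $\mathcal P$. For $m>1$ let $k_m$ (resp. $k'_m$) be the maximum exponent of an abelian power (resp. abelian repetition) of period $m$ that is a factor of $s_\alpha$. The abelian critical exponent of $s_\alpha$ is $A(s_\alpha)=\limsup_{m\to\infty}k_m/m=\limsup_{m\to\infty}k'_m/m\in[0,\infty]$ (the two coincide since $k_m\leq k'_m<k_m+2$). The Lagrange constant of $\alpha$ is $\lambda(\alpha)=\limsup_{m\to\infty}(m\|m\alpha\|)^{-1}\in[0,\infty]$. *)

theory Defs
  imports Complex_Main "HOL-Library.Extended_Real"
begin

datatype letter = a | b
hide_const (open) a b

definition dist_nearest_int :: "real \<Rightarrow> real" where
  "dist_nearest_int x = min (frac x) (1 - frac x)"

definition coding :: "real set \<Rightarrow> real set \<Rightarrow> real \<Rightarrow> real \<Rightarrow> (nat \<Rightarrow> letter) \<Rightarrow> bool" where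
  "coding Ia Ib \<alpha> \<rho> s \<longleftrightarrow>
     (\<forall>n. (frac (\<rho> + real n * \<alpha>) \<in> Ib \<longrightarrow> s n = letter.b) \<and>
          (frac (\<rho> + real n * \<alpha>) \<in> Ia \<longrightarrow> s n = letter.a))"

text \<open>In the second coding the intervals are \<open>Ib = (0, 1 - \<alpha>]\<close> and \<open>Ia = (1 - \<alpha>, 1]\<close>
  on the circle, where the points \<open>0\<close> and \<open>1\<close> are identified; as \<open>frac\<close> takes values in \<open>[0, 1)\<close>,
  the point \<open>1\<close> of \<open>Ia\<close> is represented by \<open>0\<close>.\<close>

definition sturmian_word :: "real \<Rightarrow> (nat \<Rightarrow> letter) \<Rightarrow> bool" where
  "sturmian_word \<alpha> s \<longleftrightarrow>
     (\<exists>\<rho>. 0 \<le> \<rho> \<and> \<rho> < 1 \<and>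
        (coding {1 - \<alpha>..<1} {0..<1 - \<alpha>} \<alpha> \<rho> s \<or>
         coding ({1 - \<alpha><..<1} \<union> {0}) {0<..1 - \<alpha>} \<alpha> \<rho> s))"

definition factor_of :: "'a list \<Rightarrow> (nat \<Rightarrow> 'a) \<Rightarrow> bool" where
  "factor_of w s \<longleftrightarrow> (\<exists>i. w = map s [i..<i + length w])"

definition parikh :: "letter list \<Rightarrow> nat \<times> nat" where
  "parikh w = (count_list w letter.a, count_list w letter.b)"

definition parikh_norm :: "nat \<times> nat \<Rightarrow> nat" where
  "parikh_norm P = fst P + snd P"

definition parikh_contained :: "nat \<times> nat \<Rightarrow> nat \<times> nat \<Rightarrow> bool" where
  "parikh_contained P Q \<longleftrightarrow>
     parikh_norm P < parikh_norm Q \<and> fst P \<le> fst Q \<and> snd P \<le> snd Q"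

definition abelian_power :: "nat \<Rightarrow> nat \<Rightarrow> letter list \<Rightarrow> bool" where
  "abelian_power m k w \<longleftrightarrow>
     (\<exists>us P. w = concat us \<and> length us = k \<and> (\<forall>u\<in>set us. length u = m \<and> parikh u = P))"

text \<open>An abelian repetition \<open>u\<^sub>0 u\<^sub>1 \<dots> u\<^sub>j\<^sub>-\<^sub>1 u\<^sub>j\<close> with \<open>j \<ge> 3\<close>: the list \<open>us\<close> consists
  of the \<open>j - 1 \<ge> 2\<close> inner blocks, \<open>v\<close> is \<open>u\<^sub>0\<close> and \<open>v'\<close> is \<open>u\<^sub>j\<close>. Its exponent is
  \<open>length w / m\<close>.\<close>

definition abelian_repetition :: "nat \<Rightarrow> letter list \<Rightarrow> bool" where
  "abelian_repetition m w \<longleftrightarrow>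
     (\<exists>v us v' P. w = v @ concat us @ v' \<and> length us \<ge> 2 \<and>
        (\<forall>u\<in>set us. length u = m \<and> parikh u = P) \<and>
        parikh_contained (parikh v) P \<and> parikh_contained (parikh v') P)"

text \<open>For a Sturmian word of irrational angle and a period \<open>m > 1\<close>, the two sets of exponents below
  are finite and nonempty, so that \<open>Max\<close> is their actual maximum.\<close>

definition max_power_exponent :: "(nat \<Rightarrow> letter) \<Rightarrow> nat \<Rightarrow> nat" where
  "max_power_exponent s m = Max {k. \<exists>w. factor_of w s \<and> abelian_power m k w}"

definition max_repetition_exponent :: "(nat \<Rightarrow> letter) \<Rightarrow> nat \<Rightarrow> real" where
  "max_repetition_exponent s m =
     Max {real (length w) / real m | w. factor_of w s \<and> abelian_repetition m w}"

definition abelian_critical_exponent :: "(nat \<Rightarrow> letter) \<Rightarrow> ereal" where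
  "abelian_critical_exponent s =
     limsup (\<lambda>m. ereal (real (max_power_exponent s m) / real m))"

definition abelian_critical_exponent' :: "(nat \<Rightarrow> letter) \<Rightarrow> ereal" where
  "abelian_critical_exponent' s =
     limsup (\<lambda>m. ereal (max_repetition_exponent s m / real m))"

definition lagrange_constant :: "real \<Rightarrow> ereal" where
  "lagrange_constant \<alpha> =
     limsup (\<lambda>m. ereal (inverse (real m * dist_nearest_int (real m * \<alpha>))))"

end

(* The number of letters a in a factor of length m starting at position i is
   F (rho + (i + m) alpha) - F (rho + i alpha), where F is the floor or the ceiling function.
   If k consecutive blocks of length m contain P letters a each, then k P differs from k m alpha
   by less than 1, so k ||m alpha|| < 1.  Conversely, if k ||m alpha|| < 1 and p is the integer
   nearest to m alpha, then by density of the orbit one can choose i such that the points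
   rho + i alpha + j (m alpha - p), j \<le> k, all lie strictly between the same two consecutive
   integers; the k blocks starting at i then contain p letters a each.  Hence k_m is the largest k
   with k ||m alpha|| < 1, and k_m / m differs from 1 / (m ||m alpha||) by O(1 / m). *)

theory Submission
  imports Defs
    "HOL-Analysis.Kronecker_Approximation_Theorem"
    "HOL-Analysis.Extended_Real_Limits"
begin

section \<open>Limits superior of sequences at distance O(1/m)\<close>

text \<open>The error \<open>C / m\<close> tends to 0, and adding a null sequence leaves a limsup
  unchanged; this gives one inequality in each direction. Nothing is asked at \<open>m = 0\<close>,
  where the quotients are mere default values.\<close>

lemma limsup_eq_of_diff_bounded:
  fixes f g :: "nat \<Rightarrow> real"
  assumes "\<And>m. m > 0 \<Longrightarrow> \<bar>f m - g m\<bar> \<le> C / real m"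
  shows "limsup (\<lambda>m. ereal (f m)) = limsup (\<lambda>m. ereal (g m))"
proof -
  have le: "limsup (\<lambda>m. ereal (u m)) \<le> limsup (\<lambda>m. ereal (v m))"
    if uv: "\<And>m. m > 0 \<Longrightarrow> u m \<le> C / real m + v m" for u v :: "nat \<Rightarrow> real"
  proof -
    have "limsup (\<lambda>m. ereal (u m)) \<le> limsup (\<lambda>m. ereal (C / real m) + ereal (v m))"
      by (rule Limsup_mono, rule eventually_sequentiallyI[of 1]) (use uv in simp)
    also have "\<dots> = 0 + limsup (\<lambda>m. ereal (v m))"
    proof (rule ereal_limsup_lim_add)
      have "(\<lambda>m. C / real m) \<longlonglongrightarrow> 0"
        by (rule lim_const_over_n)
      then show "(\<lambda>m. ereal (C / real m)) \<longlonglongrightarrow> 0"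
        by (simp add: zero_ereal_def)
    qed simp
    finally show ?thesis
      by simp
  qed
  have "f m \<le> C / real m + g m" "g m \<le> C / real m + f m" if "m > 0" for m
    using assms[OF that] by linarith+
  then show ?thesis
    by (intro antisym le) auto
qed

section \<open>Distance to the nearest integer\<close>

lemma dist_nearest_int_attained: "\<exists>p::int. dist_nearest_int x = \<bar>x - of_int p\<bar>"
proof (cases "frac x \<le> 1 - frac x")
  case True
  then have "dist_nearest_int x = \<bar>x - of_int \<lfloor>x\<rfloor>\<bar>"
    unfolding dist_nearest_int_def frac_def by linarith
  then show ?thesis ..
next
  case False
  then have "dist_nearest_int x = \<bar>x - of_int (\<lfloor>x\<rfloor> + 1)\<bar>"
    using frac_lt_1[of x] unfolding dist_nearest_int_def frac_def by simp
  then show ?thesis ..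
qed

text \<open>Integers up to the floor are at least \<open>frac x\<close> away, larger ones at least
  \<open>1 - frac x\<close>. The bound is needed for arbitrary \<open>p\<close>, since the letter
  count of a block is not known in advance to be the nearest integer.\<close>

lemma dist_nearest_int_le: "dist_nearest_int x \<le> \<bar>x - of_int p\<bar>"
proof (cases "p \<le> \<lfloor>x\<rfloor>")
  case True
  then have "real_of_int p \<le> of_int \<lfloor>x\<rfloor>"
    by simp
  then show ?thesis
    unfolding dist_nearest_int_def frac_def by linarith
next
  case False
  then have "real_of_int (\<lfloor>x\<rfloor> + 1) \<le> of_int p"
    by (simp only: of_int_le_iff)
  then show ?thesis
    unfolding dist_nearest_int_def frac_def by simp
qed

lemma of_nat_mult_notin_Rats:
  fixes \<alpha> :: real
  assumes "\<alpha> \<notin> \<rat>" "m > 0"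
  shows "real m * \<alpha> \<notin> \<rat>"
proof
  assume "real m * \<alpha> \<in> \<rat>"
  then have "real m * \<alpha> / real m \<in> \<rat>"
    by (intro Rats_divide) auto
  with assms show False
    by simp
qed

lemma dist_nearest_int_pos:
  assumes "x \<notin> \<rat>"
  shows "0 < dist_nearest_int x"
proof -
  have "x \<notin> \<int>"
    using assms Ints_subset_Rats by blast
  then show ?thesis
    using frac_lt_1[of x] by (simp add: dist_nearest_int_def)
qed

text \<open>Equality would make \<open>x\<close> a half-integer. The strict bound later makes
  exponent 2 available for every positive period, as abelian repetitions require two inner
  blocks.\<close>

lemma dist_nearest_int_less_half:
  assumes "x \<notin> \<rat>"
  shows "dist_nearest_int x < 1 / 2"
proof -
  have "frac x \<noteq> 1 / 2"
  proof
    assume "frac x = 1 / 2"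
    then have "x = of_int \<lfloor>x\<rfloor> + 1 / 2"
      by (simp add: frac_def)
    also have "\<dots> \<in> \<rat>"
      by (intro Rats_add Rats_divide) auto
    finally show False
      using assms by simp
  qed
  then show ?thesis
    unfolding dist_nearest_int_def by linarith
qed

section \<open>Factors, blocks and letter counts\<close>

lemma factor_of_iff_nth:
  "factor_of w s \<longleftrightarrow> (\<exists>i. \<forall>j<length w. w ! j = s (i + j))"
  unfolding factor_of_def
proof (rule iff_exI)
  fix i
  show "w = map s [i..<i + length w] \<longleftrightarrow> (\<forall>j<length w. w ! j = s (i + j))"
    by (subst list_eq_iff_nth_eq) simp
qed

lemma factor_of_infix:
  assumes "factor_of (u @ v @ w) s"
  shows "factor_of v s"
proof -
  obtain i where i: "\<And>j. j < length (u @ v @ w) \<Longrightarrow> (u @ v @ w) ! j = s (i + j)"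
    using assms unfolding factor_of_iff_nth by blast
  have "v ! j = s (i + length u + j)" if "j < length v" for j
    using i[of "length u + j"] that by (simp add: nth_append add.assoc)
  then show ?thesis
    unfolding factor_of_iff_nth by blast
qed

lemma concat_blocks:
  "concat (map (\<lambda>j. map s [i + j * m..<i + j * m + m]) [0..<k]) = map s [i..<i + k * m]"
proof (induction k)
  case (Suc k)
  have "map s [i..<i + Suc k * m] = map s ([i..<i + k * m] @ [i + k * m..<i + k * m + m])"
    by (subst upt_add_eq_append[symmetric]) (simp_all add: algebra_simps)
  then show ?case
    by (simp add: Suc.IH)
qed simp

lemma count_list_a_plus_b: "count_list w letter.a + count_list w letter.b = length w"
proof (induction w)
  case (Cons x w)
  then show ?case
    by (cases x) auto
qed simp

lemma count_list_concat_eq: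
  assumes "\<forall>u\<in>set us. count_list u x = c"
  shows "count_list (concat us) x = length us * c"
  using assms by (induction us) auto

lemma length_concat_eq:
  assumes "\<forall>u\<in>set us. length u = m"
  shows "length (concat us) = length us * m"
  using assms by (induction us) auto

section \<open>Sturmian words as increments of floor or ceiling\<close>

text \<open>Floor belongs to the first coding and ceiling to the second. The next three lemmas are
  all that is used of either, so one argument serves both codings.\<close>

definition rounding :: "(real \<Rightarrow> int) \<Rightarrow> bool" where
  "rounding F \<longleftrightarrow> F = floor \<or> F = ceiling"

text \<open>The error \<open>x - F x\<close> stays in a half-open interval of length 1, namely
  [0,1) or (-1,0], so two errors differ by less than 1.\<close>

lemma rounding_diff:
  assumes "rounding F"
  shows "\<bar>real_of_int (F y - F x) - (y - x)\<bar> < 1"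
  using assms unfolding rounding_def by (elim disjE; simp; linarith)

lemma rounding_add_of_int:
  assumes "rounding F"
  shows "F (x + of_int p) = F x + p"
  using assms unfolding rounding_def by auto

lemma rounding_const:
  assumes "rounding F" "of_int h < x" "x < of_int h + 1" "of_int h < y" "y < of_int h + 1"
  shows "F x = F y"
proof -
  have "\<lfloor>x\<rfloor> = h" "\<lfloor>y\<rfloor> = h" "\<lceil>x\<rceil> = h + 1" "\<lceil>y\<rceil> = h + 1"
    using assms(2-) by linarith+
  then show ?thesis
    using assms(1) unfolding rounding_def by auto
qed

text \<open>A step by \<alpha> yields the letter a when it crosses an integer. The codings differ
  only when the step starts or ends at an integer: floor jumps on arrival there, ceiling on
  departure.\<close>

lemma sturmian_word_rounding:
  assumes "0 < \<alpha>" "\<alpha> < 1" "sturmian_word \<alpha> s"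
  obtains \<rho> F where "rounding F"
    and "\<And>n. of_bool (s n = letter.a) = F (\<rho> + real (Suc n) * \<alpha>) - F (\<rho> + real n * \<alpha>)"
proof -
  obtain \<rho> where
    "coding {1 - \<alpha>..<1} {0..<1 - \<alpha>} \<alpha> \<rho> s \<or>
     coding ({1 - \<alpha><..<1} \<union> {0}) {0<..1 - \<alpha>} \<alpha> \<rho> s"
    using assms(3) unfolding sturmian_word_def by blast
  then show thesis
  proof
    assume c: "coding {1 - \<alpha>..<1} {0..<1 - \<alpha>} \<alpha> \<rho> s"
    have "of_bool (s n = letter.a) = \<lfloor>\<rho> + real (Suc n) * \<alpha>\<rfloor> - \<lfloor>\<rho> + real n * \<alpha>\<rfloor>" for n
    proof -
      define x where "x = \<rho> + real n * \<alpha>"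
      have next_eq: "\<rho> + real (Suc n) * \<alpha> = x + \<alpha>"
        by (simp add: x_def algebra_simps)
      have bounds: "of_int \<lfloor>x\<rfloor> \<le> x" "x < of_int \<lfloor>x\<rfloor> + 1"
        by linarith+
      show ?thesis
      proof (cases "frac x < 1 - \<alpha>")
        case True
        then have "s n = letter.b"
          using c unfolding coding_def x_def by (auto simp: frac_lt_1)
        moreover have "\<lfloor>x + \<alpha>\<rfloor> = \<lfloor>x\<rfloor>"
          using True assms(1) bounds unfolding frac_def by linarith
        ultimately show ?thesis
          unfolding next_eq x_def[symmetric] by simp
      next
        case False
        then have "s n = letter.a"
          using c unfolding coding_def x_def by (auto simp: frac_lt_1)
        moreover have "\<lfloor>x + \<alpha>\<rfloor> = \<lfloor>x\<rfloor> + 1"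
          using False assms(2) bounds unfolding frac_def by linarith
        ultimately show ?thesis
          unfolding next_eq x_def[symmetric] by simp
      qed
    qed
    then show thesis
      using that[of floor] by (simp add: rounding_def)
  next
    assume c: "coding ({1 - \<alpha><..<1} \<union> {0}) {0<..1 - \<alpha>} \<alpha> \<rho> s"
    have "of_bool (s n = letter.a) = \<lceil>\<rho> + real (Suc n) * \<alpha>\<rceil> - \<lceil>\<rho> + real n * \<alpha>\<rceil>" for n
    proof -
      define x where "x = \<rho> + real n * \<alpha>"
      have next_eq: "\<rho> + real (Suc n) * \<alpha> = x + \<alpha>"
        by (simp add: x_def algebra_simps)
      have bounds: "of_int \<lfloor>x\<rfloor> \<le> x" "x < of_int \<lfloor>x\<rfloor> + 1"
        by linarith+
      show ?thesis
      proof (cases "0 < frac x \<and> frac x \<le> 1 - \<alpha>")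
        case True
        then have "s n = letter.b"
          using c unfolding coding_def x_def by (auto simp: frac_lt_1)
        moreover have "\<lceil>x\<rceil> = \<lfloor>x\<rfloor> + 1" "\<lceil>x + \<alpha>\<rceil> = \<lfloor>x\<rfloor> + 1"
          using True assms(1) bounds unfolding frac_def by linarith+
        ultimately show ?thesis
          unfolding next_eq x_def[symmetric] by simp
      next
        case False
        then consider "frac x = 0" | "1 - \<alpha> < frac x"
          using frac_ge_0[of x] by linarith
        then show ?thesis
        proof cases
          \<comment> \<open>The point 0 stands for the endpoint 1 of the second \<open>Ia\<close>.
            Here \<open>x\<close> is an integer, and ceiling jumps on leaving it.\<close>
          case 1
          then have "s n = letter.a"
            using c unfolding coding_def x_def by (auto simp del: frac_eq_0_iff)
          moreover have "\<lceil>x\<rceil> = \<lfloor>x\<rfloor>" "\<lceil>x + \<alpha>\<rceil> = \<lfloor>x\<rfloor> + 1"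
            using 1 assms(1,2) bounds unfolding frac_def by linarith+
          ultimately show ?thesis
            unfolding next_eq x_def[symmetric] by simp
        next
          case 2
          then have "s n = letter.a"
            using c unfolding coding_def x_def by (auto simp: frac_lt_1)
          moreover have "\<lceil>x\<rceil> = \<lfloor>x\<rfloor> + 1" "\<lceil>x + \<alpha>\<rceil> = \<lfloor>x\<rfloor> + 2"
            using 2 assms(2) bounds unfolding frac_def by linarith+
          ultimately show ?thesis
            unfolding next_eq x_def[symmetric] by simp
        qed
      qed
    qed
    then show thesis
      using that[of ceiling] by (simp add: rounding_def)
  qed
qed

section \<open>Which abelian powers occur in a Sturmian word\<close>

locale sturmian =
  fixes \<alpha> \<rho> :: real and F :: "real \<Rightarrow> int" and s :: "nat \<Rightarrow> letter"
  assumes irrational: "\<alpha> \<notin> \<rat>"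
    and rounding: "rounding F"
    and letter_a: "of_bool (s n = letter.a) = F (\<rho> + real (Suc n) * \<alpha>) - F (\<rho> + real n * \<alpha>)"
begin

text \<open>The increments in \<open>letter_a\<close> telescope along a factor.\<close>

lemma count_a:
  "int (count_list (map s [i..<i + m]) letter.a) = F (\<rho> + real (i + m) * \<alpha>) - F (\<rho> + real i * \<alpha>)"
proof (induction m)
  case (Suc m)
  then show ?case
    using letter_a[of "i + m"] by auto
qed simp

text \<open>Only the total count over the whole power is compared with its length times \<alpha>.
  The rounding error is thus incurred once, not once per block, and stays below 1 whatever
  \<open>k\<close> is.\<close>

lemma abelian_power_bound:
  assumes "factor_of w s" "abelian_power m k w"
  shows "real k * dist_nearest_int (real m * \<alpha>) < 1"
proof -
  obtain us P where us: "w = concat us" "length us = k" "\<forall>u\<in>set us. length u = m \<and> parikh u = P"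
    using assms(2) unfolding abelian_power_def by blast
  have len: "length w = k * m"
    using us length_concat_eq[of us m] by simp
  obtain i where i: "w = map s [i..<i + k * m]"
    using assms(1) unfolding factor_of_def len by blast
  have "\<forall>u\<in>set us. count_list u letter.a = fst P"
    using us(3) by (auto simp: parikh_def)
  then have "count_list w letter.a = k * fst P"
    unfolding us(1) us(2)[symmetric] by (rule count_list_concat_eq)
  then have "int (k * fst P) = F (\<rho> + real (i + k * m) * \<alpha>) - F (\<rho> + real i * \<alpha>)"
    using count_a[of i "k * m"] unfolding i[symmetric] by simp
  then have "\<bar>real_of_int (int (k * fst P)) - ((\<rho> + real (i + k * m) * \<alpha>) - (\<rho> + real i * \<alpha>))\<bar> < 1"
    by (simp only: rounding_diff[OF rounding])
  also have "real_of_int (int (k * fst P)) - ((\<rho> + real (i + k * m) * \<alpha>) - (\<rho> + real i * \<alpha>))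
      = - (real k * (real m * \<alpha> - real_of_int (int (fst P))))"
    by (simp add: algebra_simps)
  finally have "real k * \<bar>real m * \<alpha> - real_of_int (int (fst P))\<bar> < 1"
    by (simp add: abs_mult)
  moreover have "real k * dist_nearest_int (real m * \<alpha>)
      \<le> real k * \<bar>real m * \<alpha> - real_of_int (int (fst P))\<bar>"
    by (intro mult_left_mono dist_nearest_int_le) simp
  ultimately show ?thesis
    by linarith
qed

lemma orbit_dense:
  assumes "lo < hi"
  obtains n :: nat and h :: int where "of_int h + lo < \<rho> + real n * \<alpha>" "\<rho> + real n * \<alpha> < of_int h + hi"
proof -
  \<comment> \<open>The target is the midpoint of the interval shifted by -\<rho>, with half the
    width as tolerance; \<open>k > 0\<close> makes \<open>nat k\<close> a valid index.\<close>
  obtain h k :: int where k: "k > 0"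
    and hk: "\<bar>of_int k * \<alpha> - of_int h - ((lo + hi) / 2 - \<rho>)\<bar> < (hi - lo) / 2"
    using sequence_of_fractional_parts_is_dense[OF irrational] assms
    by (metis diff_gt_0_iff_gt half_gt_zero)
  have "real (nat k) = of_int k"
    using k by simp
  then show thesis
    using hk by (intro that[of h "nat k"]) (simp_all add: abs_less_iff field_simps)
qed

lemma abelian_power_exists:
  assumes "real k * dist_nearest_int (real m * \<alpha>) < 1"
  shows "\<exists>w. factor_of w s \<and> abelian_power m k w"
proof -
  obtain p :: int where p: "dist_nearest_int (real m * \<alpha>) = \<bar>real m * \<alpha> - of_int p\<bar>"
    using dist_nearest_int_attained by blast
  \<comment> \<open>The signed drift modulo 1 caused by one block; its absolute value is the
    distance to the nearest integer.\<close>
  define \<delta> where "\<delta> = real m * \<alpha> - of_int p"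
  have "\<bar>real k * \<delta>\<bar> < 1"
    using assms p by (simp add: \<delta>_def abs_mult)
  \<comment> \<open>These bounds describe the offsets t for which both t and t + k\<delta> lie in
    (0,1), for either sign of \<delta>. They leave room because |k\<delta>| < 1.\<close>
  then have "max 0 (- (real k * \<delta>)) < min 1 (1 - real k * \<delta>)"
    by linarith
  then obtain i h where
    lower: "of_int h + max 0 (- (real k * \<delta>)) < \<rho> + real i * \<alpha>" and
    upper: "\<rho> + real i * \<alpha> < of_int h + min 1 (1 - real k * \<delta>)"
    by (rule orbit_dense)
  define x where "x = \<rho> + real i * \<alpha>"
  \<comment> \<open>By monotonicity in \<open>j\<close>, the intermediate points lie between those
    for 0 and \<open>k\<close>, which the choice of \<open>i\<close> controls.\<close>
  have between: "of_int h < x + real j * \<delta>" "x + real j * \<delta> < of_int h + 1" if "j \<le> k" for j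
  proof -
    have "\<delta> \<ge> 0 \<Longrightarrow> 0 \<le> real j * \<delta> \<and> real j * \<delta> \<le> real k * \<delta>"
      using that by (simp add: mult_right_mono)
    moreover have "\<delta> \<le> 0 \<Longrightarrow> real k * \<delta> \<le> real j * \<delta> \<and> real j * \<delta> \<le> 0"
      using that by (simp add: mult_right_mono_neg mult_nonneg_nonpos)
    ultimately show "of_int h < x + real j * \<delta>" "x + real j * \<delta> < of_int h + 1"
      using lower upper unfolding x_def by linarith+
  qed
  have F_eq: "F (\<rho> + real (i + j * m) * \<alpha>) = F x + int j * p" if "j \<le> k" for j
  proof -
    have "\<rho> + real (i + j * m) * \<alpha> = (x + real j * \<delta>) + of_int (int j * p)"
      by (simp add: x_def \<delta>_def algebra_simps)
    \<comment> \<open>Writing \<open>x\<close> as the case \<open>j = 0\<close> makes both arguments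
      instances of \<open>between\<close>.\<close>
    moreover have "F (x + real j * \<delta>) = F (x + real 0 * \<delta>)"
      using between[OF that] between[of 0] by (intro rounding_const[OF rounding]) auto
    ultimately show ?thesis
      by (simp only: rounding_add_of_int[OF rounding]) simp
  qed
  \<comment> \<open>Consecutive values in \<open>F_eq\<close> differ by \<open>p\<close>. Being
    equal to a count, \<open>p\<close> is nonnegative, so \<open>nat p\<close> loses
    nothing.\<close>
  have count: "count_list (map s [i + j * m..<i + j * m + m]) letter.a = nat p" if "j < k" for j
  proof -
    have "i + j * m + m = i + Suc j * m"
      by simp
    then have "int (count_list (map s [i + j * m..<i + j * m + m]) letter.a)
        = (F x + int (Suc j) * p) - (F x + int j * p)"
      using count_a[of "i + j * m" m] F_eq[of j] F_eq[of "Suc j"] that by (simp only: Suc_leI less_imp_le)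
    then show ?thesis
      by (simp add: algebra_simps)
  qed
  let ?us = "map (\<lambda>j. map s [i + j * m..<i + j * m + m]) [0..<k]"
  have "parikh u = (nat p, m - nat p) \<and> length u = m" if u: "u \<in> set ?us" for u
  proof -
    obtain j where "j < k" "u = map s [i + j * m..<i + j * m + m]"
      using u by auto
    then show ?thesis
      using count[of j] count_list_a_plus_b[of u] by (auto simp: parikh_def)
  qed
  then have "abelian_power m k (concat ?us)"
    unfolding abelian_power_def by (intro exI[of _ ?us] exI[of _ "(nat p, m - nat p)"]) simp
  moreover have "factor_of (concat ?us) s"
    unfolding concat_blocks factor_of_def by (intro exI[of _ i]) simp
  ultimately show ?thesis
    by blast
qed

text \<open>Replaces the search for words by a real inequality that is inherited by smaller
  \<open>k\<close>.\<close>

lemma power_exponents_eq: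
  "{k. \<exists>w. factor_of w s \<and> abelian_power m k w} = {k. real k * dist_nearest_int (real m * \<alpha>) < 1}"
  using abelian_power_bound abelian_power_exists by blast

section \<open>Maximal exponents for a fixed positive period\<close>

context
  fixes m :: nat
  assumes m_pos: "m > 0"
begin

lemma dist_bounds:
  "0 < dist_nearest_int (real m * \<alpha>)" "dist_nearest_int (real m * \<alpha>) < 1 / 2"
  using of_nat_mult_notin_Rats[OF irrational m_pos] dist_nearest_int_pos dist_nearest_int_less_half
  by blast+

lemma finite_power_exponents: "finite {k. real k * dist_nearest_int (real m * \<alpha>) < 1}"
proof (rule finite_subset)
  show "{k. real k * dist_nearest_int (real m * \<alpha>) < 1}
      \<subseteq> {..nat \<lceil>1 / dist_nearest_int (real m * \<alpha>)\<rceil>}"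
  proof safe
    fix k
    assume "real k * dist_nearest_int (real m * \<alpha>) < 1"
    then have "real k < 1 / dist_nearest_int (real m * \<alpha>)"
      using dist_bounds by (simp add: field_simps)
    then show "k \<le> nat \<lceil>1 / dist_nearest_int (real m * \<alpha>)\<rceil>"
      by linarith
  qed
qed simp

text \<open>The set of exponents contains 0 and is finite, so its \<open>Max\<close> is a member; as
  the set is closed downwards, membership amounts to lying below the maximum.\<close>

lemma le_max_power_exponent_iff:
  "k \<le> max_power_exponent s m \<longleftrightarrow> real k * dist_nearest_int (real m * \<alpha>) < 1"
proof -
  let ?d = "dist_nearest_int (real m * \<alpha>)"
  have max: "max_power_exponent s m = Max {k. real k * ?d < 1}"
    unfolding max_power_exponent_def power_exponents_eq ..
  have "{k. real k * ?d < 1} \<noteq> {}"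
    by (auto intro: exI[of _ 0])
  then have "max_power_exponent s m \<in> {k. real k * ?d < 1}"
    unfolding max by (intro Max_in finite_power_exponents)
  moreover have "real k * ?d \<le> real (max_power_exponent s m) * ?d" if "k \<le> max_power_exponent s m"
    using that dist_bounds by (intro mult_right_mono) auto
  moreover have "k \<le> max_power_exponent s m" if "real k * ?d < 1"
    unfolding max using that by (intro Max_ge finite_power_exponents) simp
  ultimately show ?thesis
    by force
qed

text \<open>Containment in \<open>P\<close>, whose norm is \<open>m\<close>, makes both outer words
  shorter than \<open>m\<close>, while the inner blocks form an abelian power.\<close>

lemma repetition_length_less:
  assumes "factor_of w s" "abelian_repetition m w"
  shows "length w < (max_power_exponent s m + 2) * m"
proof -
  obtain v us v' P where w: "w = v @ concat us @ v'" and "length us \<ge> 2"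
    and us: "\<forall>u\<in>set us. length u = m \<and> parikh u = P"
    and contained: "parikh_contained (parikh v) P" "parikh_contained (parikh v') P"
    using assms(2) unfolding abelian_repetition_def by blast
  have norm: "parikh_norm (parikh u) = length u" for u
    by (simp add: parikh_norm_def parikh_def count_list_a_plus_b)
  obtain u where "u \<in> set us"
    using \<open>length us \<ge> 2\<close> by (cases us) auto
  then have "length v < m" "length v' < m"
    using us contained norm unfolding parikh_contained_def by metis+
  moreover have "length us * m \<le> max_power_exponent s m * m"
  proof (rule mult_le_mono1)
    have "factor_of (concat us) s"
      using assms(1) factor_of_infix unfolding w by blast
    moreover have "abelian_power m (length us) (concat us)"
      unfolding abelian_power_def using us by blast
    ultimately show "length us \<le> max_power_exponent s m"
      using abelian_power_bound le_max_power_exponent_iff by blast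
  qed
  moreover have "length (concat us) = length us * m"
    using us by (intro length_concat_eq) blast
  moreover have "(max_power_exponent s m + 2) * m = max_power_exponent s m * m + m + m"
    by simp
  moreover have "length w = length v + length (concat us) + length v'"
    by (simp add: w)
  ultimately show ?thesis
    by linarith
qed

text \<open>A longest power, framed by empty words, is a repetition. The length bound above makes
  the set of exponents finite and limits its maximum.\<close>

lemma max_repetition_exponent_bounds:
  "real (max_power_exponent s m) \<le> max_repetition_exponent s m"
  "max_repetition_exponent s m < real (max_power_exponent s m) + 2"
proof -
  let ?E = "{real (length w) / real m | w. factor_of w s \<and> abelian_repetition m w}"
  define K where "K = max_power_exponent s m"
  have "?E \<subseteq> (\<lambda>l. real l / real m) ` {..<(K + 2) * m}"
    using repetition_length_less unfolding K_def by blast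
  then have fin: "finite ?E"
    by (rule finite_subset) simp
  have K_in: "real K \<in> ?E"
  proof -
    \<comment> \<open>Twice the distance is below 1, so two equal blocks always occur.\<close>
    have "K \<ge> 2"
      unfolding K_def le_max_power_exponent_iff using dist_bounds by simp
    have "real K * dist_nearest_int (real m * \<alpha>) < 1"
      using le_max_power_exponent_iff[of K] by (simp add: K_def)
    then obtain w where w: "factor_of w s" "abelian_power m K w"
      using abelian_power_exists by blast
    then obtain us P where us: "w = concat us" "length us = K"
        "\<forall>u\<in>set us. length u = m \<and> parikh u = P"
      unfolding abelian_power_def by blast
    obtain u where "u \<in> set us"
      using us(2) \<open>K \<ge> 2\<close> by (cases us) auto
    then have "parikh_norm P = m"
      using us(3) by (auto simp: parikh_norm_def parikh_def count_list_a_plus_b)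
    then have "parikh_contained (parikh []) P"
      using m_pos by (simp add: parikh_contained_def parikh_norm_def parikh_def)
    then have "abelian_repetition m w"
      unfolding abelian_repetition_def using us \<open>K \<ge> 2\<close>
      by (intro exI[of _ "[]"] exI[of _ us] exI[of _ P]) simp
    moreover have "real K = real (length w) / real m"
      using us length_concat_eq[of us m] m_pos by simp
    ultimately show ?thesis
      using w(1) by blast
  qed
  show "real (max_power_exponent s m) \<le> max_repetition_exponent s m"
    unfolding max_repetition_exponent_def using fin K_in K_def by (intro Max_ge) auto
  have "max_repetition_exponent s m \<in> ?E"
    unfolding max_repetition_exponent_def using fin K_in by (intro Max_in) auto
  then obtain w where "factor_of w s" "abelian_repetition m w"
    and eq: "max_repetition_exponent s m = real (length w) / real m"
    by blast
  then have "real (length w) < real ((K + 2) * m)"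
    using repetition_length_less unfolding K_def of_nat_less_iff by blast
  then show "max_repetition_exponent s m < real (max_power_exponent s m) + 2"
    using m_pos unfolding eq K_def by (simp add: field_simps)
qed

text \<open>The maximum satisfies the inequality of \<open>le_max_power_exponent_iff\<close> and its
  successor violates it.\<close>

lemma inverse_dist_bounds:
  "real (max_power_exponent s m) < inverse (dist_nearest_int (real m * \<alpha>))"
  "inverse (dist_nearest_int (real m * \<alpha>)) \<le> real (max_power_exponent s m) + 1"
proof -
  have "real (max_power_exponent s m) * dist_nearest_int (real m * \<alpha>) < 1"
    using le_max_power_exponent_iff by blast
  then show "real (max_power_exponent s m) < inverse (dist_nearest_int (real m * \<alpha>))"
    using dist_bounds by (simp add: field_simps)
  have "\<not> real (Suc (max_power_exponent s m)) * dist_nearest_int (real m * \<alpha>) < 1"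
    unfolding le_max_power_exponent_iff[symmetric] by simp
  then show "inverse (dist_nearest_int (real m * \<alpha>)) \<le> real (max_power_exponent s m) + 1"
    using dist_bounds by (simp add: field_simps)
qed

text \<open>Stated for any \<open>e\<close> in this range so as to cover powers and repetitions at
  once; the inverse distance lies in the same range of length 2.\<close>

lemma exponent_quotient_diff:
  assumes "real (max_power_exponent s m) \<le> e" "e \<le> real (max_power_exponent s m) + 2"
  shows "\<bar>e / real m - inverse (real m * dist_nearest_int (real m * \<alpha>))\<bar> \<le> 2 / real m"
proof -
  have "e / real m - inverse (real m * dist_nearest_int (real m * \<alpha>))
      = (e - inverse (dist_nearest_int (real m * \<alpha>))) / real m"
    using m_pos by (simp add: field_simps)
  moreover have "\<bar>e - inverse (dist_nearest_int (real m * \<alpha>))\<bar> \<le> 2"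
    using assms inverse_dist_bounds by linarith
  ultimately show ?thesis
    using m_pos by (simp add: divide_right_mono)
qed

end

section \<open>Passage to the limit superior\<close>

lemma abelian_critical_exponent_eq: "abelian_critical_exponent s = lagrange_constant \<alpha>"
  unfolding abelian_critical_exponent_def lagrange_constant_def
  by (rule limsup_eq_of_diff_bounded, rule exponent_quotient_diff) simp_all

lemma abelian_critical_exponent'_eq: "abelian_critical_exponent' s = lagrange_constant \<alpha>"
  unfolding abelian_critical_exponent'_def lagrange_constant_def
  by (rule limsup_eq_of_diff_bounded, rule exponent_quotient_diff)
    (simp_all add: max_repetition_exponent_bounds less_imp_le)

end

theorem theorem5p10:
  fixes \<alpha> :: real and s :: "nat \<Rightarrow> letter"
  assumes "0 < \<alpha>" and "\<alpha> < 1" and "\<alpha> \<notin> \<rat>"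
    and "sturmian_word \<alpha> s"
  shows "abelian_critical_exponent s = lagrange_constant \<alpha> \<and>
         abelian_critical_exponent' s = lagrange_constant \<alpha>"
proof -
  obtain \<rho> F where "rounding F"
    and "\<And>n. of_bool (s n = letter.a) = F (\<rho> + real (Suc n) * \<alpha>) - F (\<rho> + real n * \<alpha>)"
    using sturmian_word_rounding[OF assms(1,2,4)] by metis
  then interpret sturmian \<alpha> \<rho> F s
    using assms(3) by unfold_locales
  show ?thesis
    using abelian_critical_exponent_eq abelian_critical_exponent'_eq by blast
qed

end
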